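(* Let $\Delta \ge 3$ and $c\in[0,\Delta-2]$, $\kappa=\Delta+c$. There exists an insertion sequence on a forest of maximum degree at most $\Delta$ and a tie-breaking rule such that {\textsc{Greedy}} (maintaining a proper $\kappa$-edge-coloring) has amortized recourse $\Omega\!\left(\frac{1}{c+\sqrt{\Delta}}\right)$, with an absolute constant in the $\Omega(\cdot)$.
   Context: A dynamic forest on a fixed vertex set starts with no edges; in the incremental model every update is the insertion of an edge joining two distinct trees, and the maximum degree always stays at most $\Delta$. An algorithm must maintain after every update a proper edge coloring with palette $[\kappa]$. The recourse of an update is the number of previously colored edges whose color is changed (coloring the newly inserted edge does not count); amortized recourse is total recourse divided by the number of updates. {\textsc{Greedy}} is the algorithm that, upon insertion of an edge $e$, determines a smallest set $H$ of existing edges that can be recolored so that $e$ can receive a color, and recolors $H$ and $e$ accordingly; when several such recolorings exist, a tie-breaking rule chooses one. *)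

theory Defs
  imports Complex_Main
begin

text \<open>Simple graphs are given by their edge sets; an edge is a two-element set of vertices.\<close>

definition edge_on :: "'v set \<Rightarrow> 'v set \<Rightarrow> bool" where
  "edge_on V e \<longleftrightarrow> e \<subseteq> V \<and> card e = 2"

definition connected_in :: "'v set set \<Rightarrow> 'v \<Rightarrow> 'v \<Rightarrow> bool" where
  "connected_in E u v \<longleftrightarrow> (u, v) \<in> {(x, y). {x, y} \<in> E}\<^sup>*"

definition degree :: "'v set set \<Rightarrow> 'v \<Rightarrow> nat" where
  "degree E v = card {e \<in> E. v \<in> e}"

text \<open>
  Starting from the edgeless graph on \<open>V\<close>, each inserted edge has its endpoints in different
  components of the current graph. Hence the current graph is always a forest, and its
  components are its trees.
\<close>

definition insertion_sequence :: "'v set \<Rightarrow> nat \<Rightarrow> 'v set list \<Rightarrow> bool" where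
  "insertion_sequence V \<Delta> es \<longleftrightarrow>
     (\<forall>i < length es. edge_on V (es ! i) \<and>
        (\<forall>u \<in> es ! i. \<forall>v \<in> es ! i. u \<noteq> v \<longrightarrow> \<not> connected_in (set (take i es)) u v)) \<and>
     (\<forall>i \<le> length es. \<forall>v \<in> V. degree (set (take i es)) v \<le> \<Delta>)"

text \<open>A coloring is a partial map whose domain is the current edge set.\<close>

type_synonym 'v coloring = "'v set \<rightharpoonup> nat"

definition proper_edge_coloring :: "nat \<Rightarrow> 'v set set \<Rightarrow> 'v coloring \<Rightarrow> bool" where
  "proper_edge_coloring \<kappa> E \<phi> \<longleftrightarrow>
     dom \<phi> = E \<and> ran \<phi> \<subseteq> {1..\<kappa>} \<and>
     (\<forall>e \<in> E. \<forall>f \<in> E. e \<noteq> f \<and> e \<inter> f \<noteq> {} \<longrightarrow> \<phi> e \<noteq> \<phi> f)"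

text \<open>
  \<open>\<phi>'\<close> colors the new edge \<open>e\<close> and differs from \<open>\<phi>\<close> on the existing edges only inside \<open>H\<close>.
\<close>

definition recoloring ::
    "nat \<Rightarrow> 'v coloring \<Rightarrow> 'v set \<Rightarrow> 'v set set \<Rightarrow> 'v coloring \<Rightarrow> bool" where
  "recoloring \<kappa> \<phi> e H \<phi>' \<longleftrightarrow>
     finite H \<and> H \<subseteq> dom \<phi> \<and>
     proper_edge_coloring \<kappa> (insert e (dom \<phi>)) \<phi>' \<and>
     (\<forall>f \<in> dom \<phi> - H. \<phi>' f = \<phi> f)"

definition greedy_choice :: "nat \<Rightarrow> 'v coloring \<Rightarrow> 'v set \<Rightarrow> 'v coloring \<Rightarrow> bool" where
  "greedy_choice \<kappa> \<phi> e \<phi>' \<longleftrightarrow>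
     (\<exists>H. recoloring \<kappa> \<phi> e H \<phi>' \<and>
        (\<forall>H' \<psi>. recoloring \<kappa> \<phi> e H' \<psi> \<longrightarrow> card H \<le> card H'))"

text \<open>
  A tie-breaking rule selects one of the choices open to Greedy, given the current coloring
  (hence also the current edge set, its domain) and the new edge. Only states that admit a
  choice constrain the rule.
\<close>

definition tie_breaking_rule ::
    "nat \<Rightarrow> ('v coloring \<Rightarrow> 'v set \<Rightarrow> 'v coloring) \<Rightarrow> bool" where
  "tie_breaking_rule \<kappa> tie \<longleftrightarrow>
     (\<forall>\<phi> e. (\<exists>\<phi>'. greedy_choice \<kappa> \<phi> e \<phi>') \<longrightarrow> greedy_choice \<kappa> \<phi> e (tie \<phi> e))"

definition greedy :: "('v coloring \<Rightarrow> 'v set \<Rightarrow> 'v coloring) \<Rightarrow> 'v set list \<Rightarrow> 'v coloring" where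
  "greedy tie es = foldl tie Map.empty es"

definition recourse :: "'v coloring \<Rightarrow> 'v coloring \<Rightarrow> nat" where
  "recourse \<phi> \<phi>' = card {f \<in> dom \<phi>. \<phi>' f \<noteq> \<phi> f}"

definition amortized_recourse ::
    "('v coloring \<Rightarrow> 'v set \<Rightarrow> 'v coloring) \<Rightarrow> 'v set list \<Rightarrow> real" where
  "amortized_recourse tie es =
     real (\<Sum>i < length es. recourse (greedy tie (take i es)) (greedy tie (take (Suc i) es)))
       / real (length es)"

end

theory Submission imports Defs begin

text \<open>
  A vertex \<open>u\<close> of degree \<open>d\<close> misses \<open>\<kappa> - d\<close> colors. Insert a fresh star whose center \<open>v\<close> uses
  exactly these colors, which a suitable tie-breaking rule achieves without recourse; inserting
  \<open>{u, v}\<close> then forces a recoloring. Starting with a star of degree \<open>\<Delta> - s\<close> at \<open>u\<close> and repeating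
  this \<open>s\<close> times costs at most \<open>\<Delta> + s (c + s)\<close> insertions for \<open>s\<close> recolorings. Take
  \<open>s = \<lfloor>\<surd>\<Delta>\<rfloor>\<close>, or \<open>s = 1\<close> if \<open>c\<close> is so large that the star at \<open>v\<close> would exceed the degree bound.
\<close>

section \<open>Runs of Greedy with the ties left open\<close>

inductive greedy_run :: "nat \<Rightarrow> nat \<Rightarrow> 'v set list \<Rightarrow> 'v coloring \<Rightarrow> nat \<Rightarrow> bool"
  for \<kappa> \<Delta> where
  Nil: "greedy_run \<kappa> \<Delta> [] Map.empty 0"
| Snoc: "\<lbrakk>greedy_run \<kappa> \<Delta> es \<phi> r; x \<noteq> y; \<not> connected_in (set es) x y;
     degree (set es) x < \<Delta>; degree (set es) y < \<Delta>; greedy_choice \<kappa> \<phi> {x, y} \<phi>'\<rbrakk>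
   \<Longrightarrow> greedy_run \<kappa> \<Delta> (es @ [{x, y}]) \<phi>' (r + recourse \<phi> \<phi>')"

definition colors_at :: "'v coloring \<Rightarrow> 'v \<Rightarrow> nat set" where
  "colors_at \<phi> x = {a. \<exists>e. x \<in> e \<and> \<phi> e = Some a}"

section \<open>Connectivity, degrees and the colors at a vertex\<close>

lemma connected_in_sym: "connected_in E u v \<Longrightarrow> connected_in E v u"
proof -
  have "sym {(x, y). {x, y} \<in> E}"
    by (auto simp: sym_def insert_commute)
  then show "connected_in E u v \<Longrightarrow> connected_in E v u"
    unfolding connected_in_def by (meson sym_rtrancl symD)
qed

text \<open>No edge crosses the boundary of \<open>S\<close>, so a path that starts in
  \<open>S\<close> never leaves it. It serves for single fresh vertices and for whole fresh
  stars.\<close>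

lemma not_connected_in_if_separated:
  assumes "\<And>e. e \<in> E \<Longrightarrow> e \<subseteq> S \<or> e \<inter> S = {}" and "x \<in> S" and "y \<notin> S"
  shows "\<not> connected_in E x y"
proof
  assume "connected_in E x y"
  then have "(x, y) \<in> {(x, y). {x, y} \<in> E}\<^sup>*"
    by (simp add: connected_in_def)
  then have "y \<in> S"
  proof (induction rule: rtrancl_induct)
    case base
    then show ?case using assms(2) .
  next
    case (step y z)
    then show ?case using assms(1)[of "{y, z}"] by auto
  qed
  then show False using assms(3) by simp
qed

lemma degree_insert_le:
  assumes "finite E"
  shows "degree (insert e E) v \<le> (if v \<in> e then Suc (degree E v) else degree E v)"
proof (cases "v \<in> e")
  case True
  then have "{f \<in> insert e E. v \<in> f} = insert e {f \<in> E. v \<in> f}" by auto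
  then show ?thesis using True assms by (simp add: degree_def card_insert_le_m1 card_insert_if)
next
  case False
  then have "{f \<in> insert e E. v \<in> f} = {f \<in> E. v \<in> f}" by auto
  then show ?thesis using False by (simp add: degree_def)
qed

lemma degree_eq_0: "v \<notin> \<Union>E \<Longrightarrow> degree E v = 0"
  unfolding degree_def by (auto simp: card_eq_0_iff)

lemma proper_edge_coloringD:
  assumes "proper_edge_coloring \<kappa> E \<phi>" and "e \<in> E" "f \<in> E" "e \<noteq> f" "e \<inter> f \<noteq> {}"
  shows "\<phi> e \<noteq> \<phi> f"
  using assms unfolding proper_edge_coloring_def by blast

text \<open>Edges sharing \<open>x\<close> have distinct colors, so the coloring is injective on
  them. Degree bounds can thus be checked by counting colors.\<close>

lemma degree_eq_card_colors_at:
  assumes "proper_edge_coloring \<kappa> E \<phi>"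
  shows "degree E x = card (colors_at \<phi> x)"
proof -
  have dom: "dom \<phi> = E" using assms by (simp add: proper_edge_coloring_def)
  have "inj_on (\<lambda>e. the (\<phi> e)) {e \<in> E. x \<in> e}"
  proof (rule inj_onI, rule ccontr)
    fix e f
    assume "e \<in> {e \<in> E. x \<in> e}" "f \<in> {e \<in> E. x \<in> e}" "the (\<phi> e) = the (\<phi> f)" "e \<noteq> f"
    moreover then have "\<phi> e \<noteq> \<phi> f" 
      using assms unfolding proper_edge_coloring_def by blast
    ultimately show False using dom by (auto simp: dom_def)
  qed
  moreover have "(\<lambda>e. the (\<phi> e)) ` {e \<in> E. x \<in> e} = colors_at \<phi> x"
    using dom by (force simp: colors_at_def dom_def image_iff)
  ultimately show ?thesis unfolding degree_def by (metis card_image)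
qed

lemma colors_at_subset:
  assumes "proper_edge_coloring \<kappa> E \<phi>"
  shows "colors_at \<phi> x \<subseteq> {1..\<kappa>}"
  using assms unfolding proper_edge_coloring_def colors_at_def by (auto simp: ran_def)

lemma colors_at_isolated: "x \<notin> \<Union>(dom \<phi>) \<Longrightarrow> colors_at \<phi> x = {}"
  unfolding colors_at_def by blast

lemma colors_at_upd_new:
  assumes "e \<notin> dom \<phi>"
  shows "colors_at (\<phi>(e \<mapsto> a)) x = (if x \<in> e then insert a (colors_at \<phi> x) else colors_at \<phi> x)"
proof -
  have "(\<phi>(e \<mapsto> a)) f = Some b \<longleftrightarrow> f = e \<and> b = a \<or> \<phi> f = Some b" for f b
    using assms by (auto simp: domIff)
  then show ?thesis unfolding colors_at_def by auto
qed

lemma proper_edge_coloring_insert: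
  assumes "proper_edge_coloring \<kappa> E \<phi>" and "a \<in> {1..\<kappa>}" and "{x, y} \<notin> E"
    and "a \<notin> colors_at \<phi> x" and "a \<notin> colors_at \<phi> y"
  shows "proper_edge_coloring \<kappa> (insert {x, y} E) (\<phi>({x, y} \<mapsto> a))"
proof -
  let ?\<phi>' = "\<phi>({x, y} \<mapsto> a)"
  have free: "\<phi> f \<noteq> Some a" if "f \<inter> {x, y} \<noteq> {}" for f
    using that assms(4,5) by (auto simp: colors_at_def)
  have "?\<phi>' e \<noteq> ?\<phi>' f"
    if ef: "e \<in> insert {x, y} E" "f \<in> insert {x, y} E" "e \<noteq> f" "e \<inter> f \<noteq> {}" for e f
  proof -
    consider "e = {x, y}" | "f = {x, y}" | "e \<noteq> {x, y}" "f \<noteq> {x, y}" by blast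
    then show ?thesis
    proof cases
      case 1
      then have "\<phi> f \<noteq> Some a" using ef by (intro free) blast
      then show ?thesis using 1 ef(3) by (metis fun_upd_apply)
    next
      case 2
      then have "\<phi> e \<noteq> Some a" using ef by (intro free) blast
      then show ?thesis using 2 ef(3) by (metis fun_upd_apply)
    next
      case 3
      then have "e \<in> E" "f \<in> E" using ef(1,2) by simp_all
      then have "\<phi> e \<noteq> \<phi> f" using ef(3,4) by (rule proper_edge_coloringD[OF assms(1)])
      then show ?thesis using 3 by simp
    qed
  qed
  moreover have "dom \<phi> = E" "ran \<phi> \<subseteq> {1..\<kappa>}"
    using assms(1) unfolding proper_edge_coloring_def by blast+
  moreover from this have "ran ?\<phi>' \<subseteq> {1..\<kappa>}"
    using assms(2,3) by (subst ran_map_upd) auto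
  ultimately show ?thesis
    unfolding proper_edge_coloring_def by simp
qed

text \<open>The empty set \<open>H\<close> suffices and is trivially smallest. Hence any color free
  at both endpoints is open to the tie-breaking rule.\<close>

lemma greedy_choice_free_color:
  assumes "proper_edge_coloring \<kappa> (dom \<phi>) \<phi>" and "a \<in> {1..\<kappa>}" and "{x, y} \<notin> dom \<phi>"
    and "a \<notin> colors_at \<phi> x" and "a \<notin> colors_at \<phi> y"
  shows "greedy_choice \<kappa> \<phi> {x, y} (\<phi>({x, y} \<mapsto> a))"
  unfolding greedy_choice_def recoloring_def
  using proper_edge_coloring_insert[OF assms] assms(3)
  by (intro exI[of _ "{}"]) auto

section \<open>From runs to insertion sequences and tie-breaking rules\<close>

lemma greedy_run_proper:
  "greedy_run \<kappa> \<Delta> es \<phi> r \<Longrightarrow> proper_edge_coloring \<kappa> (set es) \<phi>"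
proof (induction rule: greedy_run.induct)
  case Nil
  then show ?case by (simp add: proper_edge_coloring_def)
next
  case (Snoc es \<phi> r x y \<phi>')
  moreover have "dom \<phi> = set es" using Snoc.IH by (simp add: proper_edge_coloring_def)
  ultimately show ?case by (auto simp: greedy_choice_def recoloring_def)
qed

lemma greedy_run_dom: "greedy_run \<kappa> \<Delta> es \<phi> r \<Longrightarrow> dom \<phi> = set es"
  using greedy_run_proper unfolding proper_edge_coloring_def by blast

lemma insertion_sequence_snoc:
  assumes "insertion_sequence V \<Delta> es" and "edge_on V {x, y}"
    and "\<not> connected_in (set es) x y"
    and "\<forall>v \<in> V. degree (insert {x, y} (set es)) v \<le> \<Delta>"
  shows "insertion_sequence V \<Delta> (es @ [{x, y}])"
  using assms connected_in_sym[of "set es" y x]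
  unfolding insertion_sequence_def
  by (auto simp: nth_append less_Suc_eq le_Suc_eq)

text \<open>Only the endpoints of a new edge gain degree, and a run demands slack there.
  \<open>V\<close> is any superset of the touched vertices, so that the final vertex set serves
  every prefix in the induction.\<close>

lemma greedy_run_insertion_sequence:
  assumes "greedy_run \<kappa> \<Delta> es \<phi> r" and "\<Union>(set es) \<subseteq> V"
  shows "insertion_sequence V \<Delta> es"
  using assms
proof (induction rule: greedy_run.induct)
  case Nil
  then show ?case by (simp add: insertion_sequence_def degree_def)
next
  case (Snoc es \<phi> r x y \<phi>')
  have "insertion_sequence V \<Delta> es" using Snoc by auto
  moreover have "degree (insert {x, y} (set es)) v \<le> \<Delta>" if "v \<in> V" for v
  proof -
    have "degree (set es) v \<le> \<Delta>"
      using \<open>insertion_sequence V \<Delta> es\<close> that unfolding insertion_sequence_def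
      by (metis order_refl take_all)
    then show ?thesis
      using degree_insert_le[of "set es" "{x, y}" v] Snoc.hyps by (auto split: if_splits)
  qed
  ultimately show ?case
    using Snoc by (intro insertion_sequence_snoc) (auto simp: edge_on_def)
qed

lemma greedy_snoc: "greedy tie (es @ [e]) = tie (greedy tie es) e"
  by (simp add: greedy_def)

text \<open>
  The coloring determines the current edge set, which grows with every insertion. So the rule can
  be redefined at the last state of a run without affecting the earlier ones.
\<close>

lemma greedy_run_realizable:
  assumes "greedy_run \<kappa> \<Delta> es \<phi> r"
  shows "\<exists>tie. tie_breaking_rule \<kappa> tie \<and> greedy tie es = \<phi> \<and>
    (\<forall>i \<le> length es. proper_edge_coloring \<kappa> (set (take i es)) (greedy tie (take i es))) \<and>
    (\<Sum>i < length es. recourse (greedy tie (take i es)) (greedy tie (take (Suc i) es))) = r"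
  using assms
proof (induction rule: greedy_run.induct)
  case Nil
  have "tie_breaking_rule \<kappa> (\<lambda>\<phi> e. SOME \<phi>'. greedy_choice \<kappa> \<phi> e \<phi>')"
    unfolding tie_breaking_rule_def by (metis someI_ex)
  then show ?case
    by (auto simp: greedy_def proper_edge_coloring_def)
next
  case (Snoc es \<phi> r x y \<phi>')
  let ?e = "{x, y}"
  obtain tie where tie: "tie_breaking_rule \<kappa> tie" "greedy tie es = \<phi>"
    "\<And>i. i \<le> length es \<Longrightarrow> proper_edge_coloring \<kappa> (set (take i es)) (greedy tie (take i es))"
    "(\<Sum>i < length es. recourse (greedy tie (take i es)) (greedy tie (take (Suc i) es))) = r"
    using Snoc.IH by blast
  define tie' where "tie' = tie(\<phi> := (tie \<phi>)(?e := \<phi>'))"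
  have "tie_breaking_rule \<kappa> tie'"
    using tie(1) Snoc.hyps unfolding tie_breaking_rule_def tie'_def by auto
  moreover have new: "?e \<notin> set es"
    using Snoc.hyps by (auto simp: connected_in_def)
  have same: "greedy tie' (take i es) = greedy tie (take i es)" if "i \<le> length es" for i
    using that
  proof (induction i)
    case (Suc i)
    \<comment> \<open>The override concerns the new edge \<open>?e\<close> only, and
      \<open>?e\<close> does not occur in \<open>es\<close>; so no earlier step consults it,
      whatever the coloring.\<close>
    have "tie' \<psi> (es ! i) = tie \<psi> (es ! i)" for \<psi>
      using new Suc.prems nth_mem[of i es] by (auto simp: tie'_def simp del: nth_mem)
    then show ?case using Suc by (simp add: take_Suc_conv_app_nth greedy_snoc)
  qed (simp add: greedy_def)
  moreover have eq: "greedy tie' (es @ [?e]) = \<phi>'"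
    using same[of "length es"] tie(2) by (simp add: greedy_snoc tie'_def)
  moreover have "proper_edge_coloring \<kappa> (set (es @ [?e])) \<phi>'"
    using greedy_run.Snoc[OF Snoc.hyps] by (rule greedy_run_proper)
  then have "\<forall>i \<le> length (es @ [?e]). proper_edge_coloring \<kappa> (set (take i (es @ [?e])))
      (greedy tie' (take i (es @ [?e])))"
    using tie(3) same eq by (auto simp: le_Suc_eq)
  moreover have "(\<Sum>i < length (es @ [?e]). recourse (greedy tie' (take i (es @ [?e])))
      (greedy tie' (take (Suc i) (es @ [?e])))) = r + recourse \<phi> \<phi>'"
    using same[of "length es"] tie(2,4) same eq by simp
  ultimately show ?case by blast
qed

section \<open>Stars inserted without recourse\<close>

lemma greedy_run_finite_Union:
  assumes "greedy_run \<kappa> \<Delta> es \<phi> r"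
  shows "finite (\<Union>(set es))"
  using assms by (induction rule: greedy_run.induct) auto

lemma greedy_run_pendant:
  assumes run: "greedy_run \<kappa> \<Delta> es \<phi> r" and w: "w \<notin> \<Union>(set es)" "w \<noteq> x"
    and deg: "degree (set es) x < \<Delta>" and a: "a \<in> {1..\<kappa>}" "a \<notin> colors_at \<phi> x"
  shows "greedy_run \<kappa> \<Delta> (es @ [{x, w}]) (\<phi>({x, w} \<mapsto> a)) r"
proof -
  note dom = greedy_run_dom[OF run]
  have new: "{x, w} \<notin> dom \<phi>" using w dom by auto
  have "colors_at \<phi> w = {}" using w dom by (intro colors_at_isolated) simp
  then have "greedy_choice \<kappa> \<phi> {x, w} (\<phi>({x, w} \<mapsto> a))"
    using greedy_run_proper[OF run] a dom new by (intro greedy_choice_free_color) simp_all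
  moreover have "\<not> connected_in (set es) x w"
    using not_connected_in_if_separated[of "set es" "{w}" w x] connected_in_sym[of "set es" x w] w
    by auto
  moreover have "recourse \<phi> (\<phi>({x, w} \<mapsto> a)) = 0"
    using new by (auto simp: recourse_def)
  ultimately show ?thesis
    using greedy_run.Snoc[OF run, of x w "\<phi>({x, w} \<mapsto> a)"] w deg degree_eq_0[of w "set es"]
    by simp
qed

text \<open>Each color of \<open>A\<close> is spent on one fresh leaf, where every color is free.
  The leaf set \<open>L\<close> and the preserved old colors are exposed so that the star can later
  be separated from the other trees and the colors at other vertices can be read off.\<close>

lemma greedy_run_star:
  fixes x :: nat
  assumes "finite A" and run: "greedy_run \<kappa> \<Delta> es \<phi> r"
    and "A \<subseteq> {1..\<kappa>}" and "A \<inter> colors_at \<phi> x = {}"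
    and "degree (set es) x + card A \<le> \<Delta>"
  shows "\<exists>es' \<phi>' L. greedy_run \<kappa> \<Delta> (es @ es') \<phi>' r \<and> length es' = card A \<and>
    colors_at \<phi>' x = colors_at \<phi> x \<union> A \<and> (\<forall>e \<in> set es. \<phi>' e = \<phi> e) \<and>
    L \<inter> insert x (\<Union>(set es)) = {} \<and> set es' = (\<lambda>w. {x, w}) ` L"
  using assms(1,3-)
proof (induction A rule: finite_induct)
  case empty
  then show ?case
    using run by (intro exI[of _ "[]"] exI[of _ \<phi>] exI[of _ "{}"]) auto
next
  case (insert a A)
  then obtain es' \<phi>' L where run': "greedy_run \<kappa> \<Delta> (es @ es') \<phi>' r" and len: "length es' = card A"
    and col: "colors_at \<phi>' x = colors_at \<phi> x \<union> A" and ext: "\<forall>e \<in> set es. \<phi>' e = \<phi> e"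
    and L: "L \<inter> insert x (\<Union>(set es)) = {}" "set es' = (\<lambda>w. {x, w}) ` L"
    by auto
  obtain w where w: "w \<notin> insert x (\<Union>(set (es @ es')))"
    using ex_new_if_finite[OF infinite_UNIV_nat] greedy_run_finite_Union[OF run'] by blast
  \<comment> \<open>The degree of the partial star is bounded through its colors, which are known
    exactly.\<close>
  have "degree (set (es @ es')) x = card (colors_at \<phi> x \<union> A)"
    using degree_eq_card_colors_at[OF greedy_run_proper[OF run']] col by simp
  also have "\<dots> \<le> card (colors_at \<phi> x) + card A"
    by (rule card_Un_le)
  also have "\<dots> < \<Delta>"
    using degree_eq_card_colors_at[OF greedy_run_proper[OF run]] insert by auto
  finally have deg: "degree (set (es @ es')) x < \<Delta>" .
  define \<phi>'' where "\<phi>'' = \<phi>'({x, w} \<mapsto> a)"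
  have "greedy_run \<kappa> \<Delta> ((es @ es') @ [{x, w}]) \<phi>'' r"
    unfolding \<phi>''_def using insert.prems insert.hyps w col deg
    by (intro greedy_run_pendant[OF run']) auto
  moreover have "{x, w} \<notin> dom \<phi>'"
    using w greedy_run_dom[OF run'] by auto
  then have "colors_at \<phi>'' x = colors_at \<phi> x \<union> insert a A"
    unfolding \<phi>''_def using col by (simp add: colors_at_upd_new)
  moreover have "\<forall>e \<in> set es. \<phi>'' e = \<phi> e"
    unfolding \<phi>''_def using ext w by auto
  ultimately show ?case
    using insert.hyps len L w
    by (intro exI[of _ "es' @ [{x, w}]"] exI[of _ \<phi>''] exI[of _ "insert w L"]) auto
qed

section \<open>Forcing a recoloring\<close>

text \<open>By \<open>cover\<close>, no color is free at both \<open>u\<close> and \<open>v\<close>,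
  so the empty set does not suffice. One edge does: moving the pendant edge \<open>{v, w}\<close>
  from \<open>a\<close> to \<open>b\<close> frees \<open>a\<close> at \<open>v\<close>, and
  \<open>a\<close> is already missing at \<open>u\<close>.\<close>

lemma greedy_choice_forced:
  assumes proper: "proper_edge_coloring \<kappa> (dom \<phi>) \<phi>" and new: "{u, v} \<notin> dom \<phi>" "u \<noteq> v"
    and cover: "colors_at \<phi> u \<union> colors_at \<phi> v = {1..\<kappa>}"
    and f: "\<phi> {v, w} = Some a" "w \<noteq> v" "w \<noteq> u" "\<And>e. e \<in> dom \<phi> \<Longrightarrow> w \<in> e \<Longrightarrow> e = {v, w}"
    and a: "a \<notin> colors_at \<phi> u" and b: "b \<in> {1..\<kappa>}" "b \<notin> colors_at \<phi> v"
  shows "greedy_choice \<kappa> \<phi> {u, v} (\<phi>({v, w} \<mapsto> b, {u, v} \<mapsto> a))"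
    and "recourse \<phi> (\<phi>({v, w} \<mapsto> b, {u, v} \<mapsto> a)) = 1"
proof -
  let ?f = "{v, w}" and ?e = "{u, v}"
  let ?\<phi>' = "\<phi>(?f \<mapsto> b, ?e \<mapsto> a)"
  have neq: "?f \<noteq> ?e" using f new by (auto simp: doubleton_eq_iff)
  have a_range: "a \<in> {1..\<kappa>}"
    using colors_at_subset[OF proper, of v] f(1) unfolding colors_at_def by blast
  have ab: "a \<noteq> b" using b(2) f(1) by (auto simp: colors_at_def)
  \<comment> \<open>At \<open>u\<close> the color \<open>a\<close> is missing; at \<open>v\<close>
    it is taken by \<open>?f\<close> alone.\<close>
  have at_e: "\<phi> g \<noteq> Some a" if "g \<noteq> ?f" "g \<inter> ?e \<noteq> {}" "g \<in> dom \<phi>" for g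
  proof (cases "u \<in> g")
    case True
    then show ?thesis using a by (auto simp: colors_at_def)
  next
    case False
    then have "g \<inter> ?f \<noteq> {}" using that by auto
    then show ?thesis
      using proper that f(1) unfolding proper_edge_coloring_def by (metis domI)
  qed
  \<comment> \<open>Since \<open>w\<close> is a leaf, any other edge meeting \<open>?f\<close> does
    so in \<open>v\<close>, where \<open>b\<close> is missing.\<close>
  have at_f: "\<phi> g \<noteq> Some b" if "g \<noteq> ?f" "g \<inter> ?f \<noteq> {}" "g \<in> dom \<phi>" for g
    using that f(4)[of g] b(2) by (auto simp: colors_at_def)
  have at_e': "?\<phi>' g \<noteq> Some a" if "g \<noteq> ?e" "g \<inter> ?e \<noteq> {}" "g \<in> dom \<phi>" for g
    using at_e[OF _ that(2,3)] that(1) ab by (cases "g = ?f") auto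
  have at_f': "?\<phi>' g \<noteq> Some b" if "g \<noteq> ?f" "g \<inter> ?f \<noteq> {}" "g \<in> insert ?e (dom \<phi>)" for g
    using at_f[OF that(1,2)] that(1,3) ab by (cases "g = ?e") auto
  have "?\<phi>' g \<noteq> ?\<phi>' h"
    if gh: "g \<in> insert ?e (dom \<phi>)" "h \<in> insert ?e (dom \<phi>)" "g \<noteq> h" "g \<inter> h \<noteq> {}" for g h
  proof -
    consider "g = ?e" | "h = ?e" | "g = ?f" | "h = ?f"
      | "g \<noteq> ?e" "g \<noteq> ?f" "h \<noteq> ?e" "h \<noteq> ?f"
      by blast
    then show ?thesis
    proof cases
      case 1
      have "?\<phi>' h \<noteq> Some a" using gh 1 by (intro at_e') blast+
      moreover have "?\<phi>' g = Some a" using 1 by simp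
      ultimately show ?thesis by metis
    next
      case 2
      have "?\<phi>' g \<noteq> Some a" using gh 2 by (intro at_e') blast+
      moreover have "?\<phi>' h = Some a" using 2 by simp
      ultimately show ?thesis by metis
    next
      case 3
      have "?\<phi>' h \<noteq> Some b" using gh 3 by (intro at_f') blast+
      moreover have "?\<phi>' g = Some b" using 3 neq by simp
      ultimately show ?thesis by metis
    next
      case 4
      have "?\<phi>' g \<noteq> Some b" using gh 4 by (intro at_f') blast+
      moreover have "?\<phi>' h = Some b" using 4 neq by simp
      ultimately show ?thesis by metis
    next
      case 5
      then have "?\<phi>' g = \<phi> g" "?\<phi>' h = \<phi> h" by simp_all
      moreover have "\<phi> g \<noteq> \<phi> h"
        using gh 5 by (intro proper_edge_coloringD[OF proper]) simp_all
      ultimately show ?thesis by metis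
    qed
  qed
  moreover have "dom ?\<phi>' = insert ?e (dom \<phi>)" using f(1) by auto
  moreover have "ran ?\<phi>' \<subseteq> {1..\<kappa>}"
    using proper a_range b(1) unfolding proper_edge_coloring_def
    by (auto simp: ran_def split: if_splits)
  ultimately have "proper_edge_coloring \<kappa> (insert ?e (dom \<phi>)) ?\<phi>'"
    unfolding proper_edge_coloring_def by blast
  then have rec: "recoloring \<kappa> \<phi> ?e {?f} ?\<phi>'"
    using f(1) new unfolding recoloring_def by auto
  have "card {?f} \<le> card H" if "recoloring \<kappa> \<phi> ?e H \<psi>" for H \<psi>
  proof (rule ccontr)
    assume "\<not> ?thesis"
    \<comment> \<open>As \<open>recoloring\<close> demands a finite \<open>H\<close>, cardinality 0
      does mean that \<open>H\<close> is empty, so all old edges keep their colors.\<close>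
    then have "card H = 0" by simp
    then have same: "\<forall>g \<in> dom \<phi>. \<psi> g = \<phi> g"
      and proper_\<psi>: "proper_edge_coloring \<kappa> (insert ?e (dom \<phi>)) \<psi>"
      using that by (auto simp: recoloring_def)
    then obtain k where k: "\<psi> ?e = Some k" "k \<in> {1..\<kappa>}"
      unfolding proper_edge_coloring_def by (metis domD insertI1 ranI subset_iff)
    \<comment> \<open>By \<open>cover\<close>, the color \<open>k\<close> of the new edge already
      sits on an old edge at \<open>u\<close> or \<open>v\<close>.\<close>
    obtain g where g: "g \<inter> ?e \<noteq> {}" "\<phi> g = Some k"
      using cover k(2) unfolding colors_at_def by blast
    have "g \<in> dom \<phi>" using g(2) by (rule domI)
    moreover from this have "g \<noteq> ?e" using new(1) by metis
    ultimately have "\<psi> g \<noteq> \<psi> ?e"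
      using g(1) by (intro proper_edge_coloringD[OF proper_\<psi>]) simp_all
    moreover have "\<psi> g = \<psi> ?e" using same \<open>g \<in> dom \<phi>\<close> k(1) g(2) by metis
    ultimately show False by simp
  qed
  with rec show "greedy_choice \<kappa> \<phi> ?e ?\<phi>'" unfolding greedy_choice_def by blast
  have "{g \<in> dom \<phi>. ?\<phi>' g \<noteq> \<phi> g} = {?f}"
    using f(1) new ab neq by auto
  then show "recourse \<phi> ?\<phi>' = 1" by (simp add: recourse_def)
qed

text \<open>The star at a fresh \<open>v\<close> has one edge per color missing at \<open>u\<close>;
  the \<open>Suc\<close> in the length is the joining edge. The bound
  \<open>\<kappa> - degree (set es) u < \<Delta>\<close> reserves room for that edge at
  \<open>v\<close>.\<close>

lemma greedy_run_recourse_round: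
  fixes u :: nat
  assumes run: "greedy_run \<kappa> \<Delta> es \<phi> r" and deg: "degree (set es) u < \<Delta>"
    and \<kappa>: "\<Delta> \<le> \<kappa>" "\<kappa> - degree (set es) u < \<Delta>"
  shows "\<exists>es' \<phi>'. greedy_run \<kappa> \<Delta> (es @ es') \<phi>' (Suc r) \<and>
    length es' = Suc (\<kappa> - degree (set es) u) \<and>
    degree (set (es @ es')) u = Suc (degree (set es) u)"
proof -
  let ?d = "degree (set es) u"
  note proper = greedy_run_proper[OF run]
  define A where "A = {1..\<kappa>} - colors_at \<phi> u"
  have card_A: "card A = \<kappa> - ?d"
    using colors_at_subset[OF proper, of u] degree_eq_card_colors_at[OF proper, of u]
    unfolding A_def by (simp add: card_Diff_subset finite_subset)
  obtain v where v: "v \<notin> insert u (\<Union>(set es))"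
    using ex_new_if_finite[OF infinite_UNIV_nat] greedy_run_finite_Union[OF run] by blast
  then have deg_v: "degree (set es) v = 0" by (intro degree_eq_0) simp
  have "colors_at \<phi> v = {}" using v greedy_run_dom[OF run] by (intro colors_at_isolated) simp
  then obtain es' \<phi>' L where run': "greedy_run \<kappa> \<Delta> (es @ es') \<phi>' r" and len: "length es' = card A"
    and col: "colors_at \<phi>' v = A" and ext: "\<forall>e \<in> set es. \<phi>' e = \<phi> e"
    and L: "L \<inter> insert v (\<Union>(set es)) = {}" "set es' = (\<lambda>w. {v, w}) ` L"
    using greedy_run_star[of A \<kappa> \<Delta> es \<phi> r v] run card_A \<kappa>(2) deg_v by (auto simp: A_def)
  note proper' = greedy_run_proper[OF run'] and dom' = greedy_run_dom[OF run']
  \<comment> \<open>\<open>u\<close> misses some color because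
    \<open>?d < \<Delta> \<le> \<kappa>\<close>; the star edge of this color is the one to be
    recolored.\<close>
  obtain a where a: "a \<in> A" using card_A deg \<kappa>(1)
    by (metis all_not_in_conv card.empty diff_is_0_eq not_le order_less_le_trans)
  obtain g where g: "v \<in> g" "\<phi>' g = Some a" using a col by (auto simp: colors_at_def)
  then have "g \<in> set es'" using v dom' by (metis UnE UnionI domI insertCI set_append)
  then obtain w where w: "w \<in> L" "g = {v, w}" using L by auto
  \<comment> \<open>\<open>\<kappa> - ?d < \<Delta> \<le> \<kappa>\<close> excludes
    \<open>?d = 0\<close>. So \<open>u\<close> lies on an old edge, and the leaves \<open>L\<close>,
    which avoid all old vertices, do not include it.\<close>
  have "?d > 0" using \<kappa> by (cases ?d) auto
  then have u: "u \<in> \<Union>(set es)" using degree_eq_0[of u "set es"] by auto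
  then have u': "u \<notin> insert v L" using L(1) v by auto
  have col_u: "colors_at \<phi>' u = colors_at \<phi> u"
  proof -
    have "\<phi>' e = \<phi> e" if "u \<in> e" for e
    proof (cases "e \<in> set es")
      case False
      moreover have "e \<notin> set es'" using that L(2) u' by auto
      ultimately have "e \<notin> dom \<phi>" "e \<notin> dom \<phi>'" using dom' greedy_run_dom[OF run] by auto
      then show ?thesis by (simp add: domIff)
    qed (use ext in simp)
    then show ?thesis unfolding colors_at_def by metis
  qed
  \<comment> \<open>\<open>A\<close> has \<open>\<kappa> - ?d < \<kappa>\<close> elements, so some
    color \<open>b\<close> is left at \<open>v\<close> to replace \<open>a\<close>.\<close>
  have "\<not> {1..\<kappa>} \<subseteq> A"
    using card_mono[of A "{1..\<kappa>}"] card_A \<kappa> by (auto simp: A_def)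
  then obtain b where b: "b \<in> {1..\<kappa>}" "b \<notin> A" by blast
  let ?\<phi>'' = "\<phi>'({v, w} \<mapsto> b, {u, v} \<mapsto> a)"
  have new: "{u, v} \<notin> dom \<phi>'" "u \<noteq> v"
    using dom' L(2) v u' by (auto simp: doubleton_eq_iff)
  have cover: "colors_at \<phi>' u \<union> colors_at \<phi>' v = {1..\<kappa>}"
    using col_u col colors_at_subset[OF proper, of u] by (auto simp: A_def)
  have pendant: "e = {v, w}" if "e \<in> dom \<phi>'" "w \<in> e" for e
    using that dom' L w(1) by auto
  have proper'': "proper_edge_coloring \<kappa> (dom \<phi>') \<phi>'" using proper' dom' by simp
  have "w \<noteq> v" "w \<noteq> u" using L w u' by auto
  moreover have "\<phi>' {v, w} = Some a" using g w by simp
  moreover have "a \<notin> colors_at \<phi>' u" using a col_u by (simp add: A_def)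
  moreover have "b \<notin> colors_at \<phi>' v" using b col by simp
  ultimately have choice: "greedy_choice \<kappa> \<phi>' {u, v} ?\<phi>''" and rec: "recourse \<phi>' ?\<phi>'' = 1"
    using greedy_choice_forced[OF proper'' new cover, of w a b] pendant b by blast+
  have inc: "{f \<in> set (es @ es'). u \<in> f} = {f \<in> set es. u \<in> f}"
    using L u' by auto
  then have deg_u: "degree (set (es @ es')) u = ?d" by (simp add: degree_def)
  have "degree (set (es @ es')) v < \<Delta>"
    using degree_eq_card_colors_at[OF proper', of v] col card_A \<kappa> by simp
  \<comment> \<open>The star at \<open>v\<close> is a tree of its own: its edges stay within
    \<open>insert v L\<close>, and old edges avoid that set.\<close>
  moreover have "\<not> connected_in (set (es @ es')) v u"
    using L v u' by (intro not_connected_in_if_separated[of _ "insert v L"]) auto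
  then have "\<not> connected_in (set (es @ es')) u v" using connected_in_sym by metis
  ultimately have "greedy_run \<kappa> \<Delta> ((es @ es') @ [{u, v}]) ?\<phi>'' (r + recourse \<phi>' ?\<phi>'')"
    using new(2) deg_u deg choice by (intro greedy_run.Snoc[OF run']) auto
  moreover have "{f \<in> set (es @ es' @ [{u, v}]). u \<in> f} = insert {u, v} {f \<in> set es. u \<in> f}"
    using inc by auto
  then have "degree (set (es @ es' @ [{u, v}])) u = Suc ?d"
    using new(1) dom' by (simp add: degree_def)
  ultimately show ?thesis
    using rec len card_A by (intro exI[of _ "es' @ [{u, v}]"] exI[of _ ?\<phi>'']) simp
qed

section \<open>Number of rounds and insertions\<close>

text \<open>After \<open>k\<close> rounds \<open>u\<close> misses
  \<open>\<kappa> - (\<Delta> - s + k) = c + s - k\<close> colors, so the next round costs at most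
  \<open>c + s + 1\<close> insertions. The first round has the largest star, and
  \<open>c + s < \<Delta>\<close> is the degree condition for it.\<close>

lemma greedy_run_recourse_rounds:
  fixes u :: nat
  assumes "\<kappa> = \<Delta> + c" and "c + s < \<Delta>" and "k \<le> s"
  shows "\<exists>es \<phi>. greedy_run \<kappa> \<Delta> es \<phi> k \<and> length es \<le> \<Delta> - s + k * (c + s + 1) \<and>
    degree (set es) u = \<Delta> - s + k"
  using assms(3)
proof (induction k)
  case 0
  have sub: "{1..\<Delta> - s} \<subseteq> {1..\<kappa>}" using assms(1) by auto
  have "colors_at Map.empty u = {}" by (simp add: colors_at_def)
  moreover have "degree {} u = 0" by (simp add: degree_def)
  ultimately obtain es \<phi> where run: "greedy_run \<kappa> \<Delta> es \<phi> 0" and len: "length es = \<Delta> - s"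
    and "colors_at \<phi> u = {1..\<Delta> - s}"
    using greedy_run_star[OF finite_atLeastAtMost greedy_run.Nil sub, of u \<Delta>] by auto
  then show ?case
    using degree_eq_card_colors_at[OF greedy_run_proper[OF run], of u] by auto
next
  case (Suc k)
  then obtain es \<phi> where run: "greedy_run \<kappa> \<Delta> es \<phi> k"
    and len: "length es \<le> \<Delta> - s + k * (c + s + 1)" and deg: "degree (set es) u = \<Delta> - s + k"
    by auto
  obtain es' \<phi>' where "greedy_run \<kappa> \<Delta> (es @ es') \<phi>' (Suc k)"
    and "length es' = Suc (\<kappa> - (\<Delta> - s + k))"
    and "degree (set (es @ es')) u = Suc (\<Delta> - s + k)"
    using greedy_run_recourse_round[OF run, of u, unfolded deg] assms(1,2) Suc.prems by force
  then show ?case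
    using len assms(1,2) Suc.prems by (intro exI[of _ "es @ es'"] exI[of _ \<phi>']) auto
qed

text \<open>The rounds must pay for an initial star of up to \<open>\<Delta>\<close> edges. About
  \<open>sqrt \<Delta>\<close> rounds do so, while \<open>s * (c + s)\<close> stays within
  \<open>s * (c + sqrt \<Delta>)\<close>. If this \<open>s\<close> breaks the degree bound, then
  \<open>\<Delta> \<le> c + sqrt \<Delta>\<close> and one round already pays.\<close>

lemma exists_number_of_rounds:
  fixes \<Delta> c :: nat
  assumes "\<Delta> \<ge> 3" and "c \<le> \<Delta> - 2"
  shows "\<exists>s \<ge> 1. c + s < \<Delta> \<and> real (\<Delta> + s * (c + s)) \<le> 5 * real s * (real c + sqrt \<Delta>)"
proof (cases "c + nat \<lfloor>sqrt \<Delta>\<rfloor> < \<Delta>")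
  case True
  define s where "s = nat \<lfloor>sqrt \<Delta>\<rfloor>"
  have ge: "sqrt \<Delta> \<ge> 1" using assms by simp
  then have s: "real s \<le> sqrt \<Delta>" "sqrt \<Delta> < real s + 1" "s \<ge> 1"
    unfolding s_def by linarith+
  \<comment> \<open>\<open>sqrt \<Delta> < s + 1 \<le> 2 * s\<close> bounds the first factor. This
    estimate contributes 4 to the constant 5, the next one contributes 1.\<close>
  then have "sqrt \<Delta> * sqrt \<Delta> \<le> (2 * real s) * (2 * (real c + sqrt \<Delta>))"
    by (intro mult_mono) auto
  moreover have "real s * (real c + real s) \<le> real s * (real c + sqrt \<Delta>)"
    using s by (intro mult_left_mono) auto
  ultimately have "real (\<Delta> + s * (c + s)) \<le> 5 * real s * (real c + sqrt \<Delta>)"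
    by (simp add: algebra_simps)
  moreover have "c + s < \<Delta>" using True by (simp add: s_def)
  ultimately show ?thesis using s(3) by (intro exI[of _ s] conjI)
next
  case False
  define x where "x = sqrt \<Delta>"
  have "x \<ge> 1" using assms by (simp add: x_def)
  moreover have "real (nat \<lfloor>x\<rfloor>) \<le> x" using \<open>x \<ge> 1\<close> by (intro of_nat_floor) simp
  then have "real \<Delta> \<le> real c + x" using False unfolding x_def[symmetric] by linarith
  ultimately have "real (\<Delta> + 1 * (c + 1)) \<le> 5 * real 1 * (real c + x)" by simp
  moreover have "c + 1 < \<Delta>" using assms by simp
  ultimately show ?thesis unfolding x_def by (intro exI[of _ 1] conjI) simp_all
qed

theorem theorem2p2:
  "\<exists>C :: real. C > 0 \<and>
     (\<forall>\<Delta> c \<kappa> :: nat. \<Delta> \<ge> 3 \<and> c \<le> \<Delta> - 2 \<and> \<kappa> = \<Delta> + c \<longrightarrow>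
        (\<exists>(V :: nat set) es tie.
           finite V \<and> es \<noteq> [] \<and> insertion_sequence V \<Delta> es \<and> tie_breaking_rule \<kappa> tie \<and>
           (\<forall>i \<le> length es.
              proper_edge_coloring \<kappa> (set (take i es)) (greedy tie (take i es))) \<and>
           amortized_recourse tie es \<ge> C / (real c + sqrt (real \<Delta>))))"
proof (intro exI[of _ "1 / 5"] conjI allI impI)
  fix \<Delta> c \<kappa> :: nat
  assume asm: "\<Delta> \<ge> 3 \<and> c \<le> \<Delta> - 2 \<and> \<kappa> = \<Delta> + c"
  then obtain s where s: "s \<ge> 1" "c + s < \<Delta>"
    and bound: "real (\<Delta> + s * (c + s)) \<le> 5 * real s * (real c + sqrt \<Delta>)"
    using exists_number_of_rounds by blast
  obtain es \<phi> where run: "greedy_run \<kappa> \<Delta> es \<phi> s"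
    and len: "length es \<le> \<Delta> - s + s * (c + s + 1)" and deg: "degree (set es) (0 :: nat) = \<Delta>"
    using greedy_run_recourse_rounds[of \<kappa> \<Delta> c s s 0] asm s by auto
  obtain tie where tie: "tie_breaking_rule \<kappa> tie"
    "\<forall>i \<le> length es. proper_edge_coloring \<kappa> (set (take i es)) (greedy tie (take i es))"
    "(\<Sum>i < length es. recourse (greedy tie (take i es)) (greedy tie (take (Suc i) es))) = s"
    using greedy_run_realizable[OF run] by blast
  have ne: "es \<noteq> []" using deg asm by (auto simp: degree_def)
  have pos: "real c + sqrt \<Delta> > 0" using asm by (simp add: add_nonneg_pos)
  \<comment> \<open>The \<open>s\<close> joining edges make up for the \<open>s\<close> edges left
    out of the initial star.\<close>
  have "length es \<le> \<Delta> + s * (c + s)" using len s by simp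
  then have "real (length es) \<le> 5 * real s * (real c + sqrt \<Delta>)" using bound by linarith
  \<comment> \<open>There are \<open>s\<close> recolorings over at most
    \<open>5 * s * (c + sqrt \<Delta>)\<close> insertions, whence the constant
    \<open>1 / 5\<close>.\<close>
  then have "1 / 5 / (real c + sqrt \<Delta>) \<le> amortized_recourse tie es"
    using tie(3) pos ne unfolding amortized_recourse_def by (simp add: field_simps)
  then show "\<exists>(V :: nat set) es tie.
           finite V \<and> es \<noteq> [] \<and> insertion_sequence V \<Delta> es \<and> tie_breaking_rule \<kappa> tie \<and>
           (\<forall>i \<le> length es.
              proper_edge_coloring \<kappa> (set (take i es)) (greedy tie (take i es))) \<and>
           amortized_recourse tie es \<ge> 1 / 5 / (real c + sqrt (real \<Delta>))"
    \<comment> \<open>The vertex set is \<open>\<Union>(set es)\<close>, fixed by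
      \<open>order_refl\<close>.\<close>
    using greedy_run_finite_Union[OF run] greedy_run_insertion_sequence[OF run order_refl] ne tie
    by blast
qed simp

end
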